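(* Let $\mathbf{F}(\mathbf{x}) = A\mathbf{x}$ be a vector field on $\mathbb{R}^n$, where $A$ is a real normal $n\times n$ matrix (i.e. $AA^T = A^TA$). Then there is a strictly orthogonal Helmholtz--Hodge decomposition of $\mathbf{F}$ on $\mathbb{R}^n$.
   Context: A Helmholtz--Hodge decomposition (HHD) of a vector field $\mathbf{F}$ on a domain $\Omega\subset\mathbb{R}^n$ is a decomposition $\mathbf{F} = -\nabla V + \mathbf{u}$, where $V:\Omega\to\mathbb{R}$ is a $C^3$ function and $\mathbf{u}$ is a vector field on $\Omega$ with $\nabla\cdot\mathbf{u} = 0$. Here all HHDs are defined on $\Omega=\mathbb{R}^n$. The HHD is strictly orthogonal on $\Omega$ if $\mathbf{u}(\mathbf{x})\cdot\nabla V(\mathbf{x}) = 0$ for all $\mathbf{x}\in\Omega$. *)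

theory Defs
  imports "HOL-Analysis.Analysis"
begin

(* f is of class C^k on the open set S.  The directional derivative is taken in every
   direction v, which by linearity is the same as taking all partial derivatives. *)
fun C_k_on :: "nat \<Rightarrow> ('a::real_normed_vector \<Rightarrow> 'b::real_normed_vector) \<Rightarrow> 'a set \<Rightarrow> bool" where
  "C_k_on 0 f S \<longleftrightarrow> continuous_on S f"
| "C_k_on (Suc k) f S \<longleftrightarrow>
     (\<forall>x\<in>S. f differentiable (at x)) \<and>
     (\<forall>v. C_k_on k (\<lambda>x. frechet_derivative f (at x) v) S)"

(* Meaningful only where f is differentiable. *)
definition gradient :: "('a::real_inner \<Rightarrow> real) \<Rightarrow> 'a \<Rightarrow> 'a" where
  "gradient f x = (THE D. GDERIV f x :> D)"

lemma gradient_eq: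
  assumes "GDERIV f x :> D"
  shows "gradient f x = D"
  unfolding gradient_def
proof (rule the_equality)
  show "GDERIV f x :> D" by (fact assms)
  fix D' assume "GDERIV f x :> D'"
  then have "(\<lambda>h. inner h D') = (\<lambda>h. inner h D)"
    using assms has_derivative_unique unfolding gderiv_def by metis
  then have "\<forall>h. inner h D' = inner h D"
    by (simp add: fun_eq_iff)
  then show "D' = D"
    by (simp only: vector_eq_ldot)
qed

(* The trace of the total derivative; meaningful only where u is differentiable. *)
definition divergence :: "('a::euclidean_space \<Rightarrow> 'a) \<Rightarrow> 'a \<Rightarrow> real" where
  "divergence u x = (\<Sum>b\<in>Basis. frechet_derivative u (at x) b \<bullet> b)"

(* Differentiability of u is stated explicitly, so that its divergence is well-defined. *)
definition Helmholtz_Hodge_decomposition ::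
  "'a::euclidean_space set \<Rightarrow> ('a \<Rightarrow> 'a) \<Rightarrow> ('a \<Rightarrow> real) \<Rightarrow> ('a \<Rightarrow> 'a) \<Rightarrow> bool" where
  "Helmholtz_Hodge_decomposition S F V u \<longleftrightarrow>
     open S \<and> connected S \<and> S \<noteq> {} \<and>
     C_k_on 3 V S \<and>
     (\<forall>x\<in>S. u differentiable (at x) \<and> divergence u x = 0) \<and>
     (\<forall>x\<in>S. F x = - gradient V x + u x)"

definition strictly_orthogonal_on ::
  "'a::euclidean_space set \<Rightarrow> ('a \<Rightarrow> real) \<Rightarrow> ('a \<Rightarrow> 'a) \<Rightarrow> bool" where
  "strictly_orthogonal_on S V u \<longleftrightarrow> (\<forall>x\<in>S. u x \<bullet> gradient V x = 0)"

end

theory Submission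
  imports Defs
begin

text \<open>
  Split \<open>A\<close> into its symmetric part \<open>S = (A + A\<^sup>T) / 2\<close> and its antisymmetric part
  \<open>K = (A - A\<^sup>T) / 2\<close>.  A linear field with symmetric matrix is conservative: \<open>S x\<close> is minus the
  gradient of \<open>V x = - (x \<bullet> A x) / 2\<close>, as a quadratic form sees the symmetric part alone
  (\<open>gderiv_quadratic_form\<close>).  A linear field with antisymmetric matrix has divergence
  equal to the trace of that matrix, which vanishes.  So \<open>u x = K x\<close> gives a
  Helmholtz--Hodge decomposition for every \<open>A\<close>, and normality is what makes it orthogonal:
  \<open>4 (K x \<bullet> S x) = (A x - A\<^sup>T x) \<bullet> (A x + A\<^sup>T x) = \<parallel>A x\<parallel>\<^sup>2 - \<parallel>A\<^sup>T x\<parallel>\<^sup>2\<close>, and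
  a normal matrix and its transpose stretch every vector equally (\<open>normal_matrix_inner_eq\<close>).
\<close>

lemma C_k_on_const: "C_k_on k (\<lambda>x. c) S"
  by (induction k arbitrary: c) simp_all

text \<open>The derivative of a bounded linear map is the same at every point, so all further
  derivatives vanish.  This settles the smoothness of a quadratic potential, whose directional
  derivatives are linear.\<close>

lemma C_k_on_bounded_linear:
  assumes "bounded_linear f"
  shows "C_k_on k f S"
proof (cases k)
  case 0
  then show ?thesis
    using assms by (simp add: linear_continuous_on)
next
  case (Suc j)
  have "frechet_derivative f (at x) = f" for x
    using assms by (metis bounded_linear_imp_has_derivative frechet_derivative_at)
  then show ?thesis
    using assms Suc by (simp add: bounded_linear_imp_differentiable C_k_on_const)
qed

text \<open>The product rule differentiates each of the two occurrences of \<open>x\<close>; moving \<open>A\<close> across the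
  inner product in one of the two terms is where the transpose comes from.\<close>

lemma gderiv_quadratic_form:
  fixes A :: "real ^ 'n ^ 'n"
  shows "GDERIV (\<lambda>x. x \<bullet> (A *v x)) x :> A *v x + transpose A *v x"
proof -
  have "((\<lambda>x. x \<bullet> (A *v x)) has_derivative (\<lambda>h. x \<bullet> (A *v h) + h \<bullet> (A *v x))) (at x)"
    by (intro has_derivative_inner has_derivative_ident
        bounded_linear_imp_has_derivative matrix_vector_mul_bounded_linear)
  moreover have "x \<bullet> (A *v h) + h \<bullet> (A *v x) = h \<bullet> (A *v x + transpose A *v x)" for h
    by (metis add.commute dot_lmul_matrix inner_add_right inner_commute
        transpose_matrix_vector)
  ultimately show ?thesis
    by (simp add: gderiv_def)
qed

text \<open>The two squared norms are the quadratic forms of \<open>A\<^sup>T A\<close> and \<open>A A\<^sup>T\<close>.\<close>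

lemma normal_matrix_inner_eq:
  fixes A :: "real ^ 'n ^ 'n"
  assumes "A ** transpose A = transpose A ** A"
  shows "(A *v x) \<bullet> (A *v x) = (transpose A *v x) \<bullet> (transpose A *v x)"
proof -
  have "(A *v x) \<bullet> (A *v x) = x \<bullet> ((transpose A ** A) *v x)"
    by (metis dot_lmul_matrix inner_commute matrix_vector_mul_assoc transpose_matrix_vector)
  also have "\<dots> = x \<bullet> ((A ** transpose A) *v x)"
    by (simp only: assms)
  also have "\<dots> = (transpose A *v x) \<bullet> (transpose A *v x)"
    by (metis dot_lmul_matrix matrix_vector_mul_assoc transpose_matrix_vector)
  finally show ?thesis .
qed

theorem theorem2:
  fixes A :: "real ^ 'n ^ 'n"
    and F :: "real ^ 'n \<Rightarrow> real ^ 'n"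
  assumes "A ** transpose A = transpose A ** A"
    and "\<And>x. F x = A *v x"
  shows "\<exists>V u. Helmholtz_Hodge_decomposition UNIV F V u \<and> strictly_orthogonal_on UNIV V u"
proof -
  define V :: "real ^ 'n \<Rightarrow> real" where "V = (\<lambda>x. - (1/2) * (x \<bullet> (A *v x)))"
  define S :: "real ^ 'n \<Rightarrow> real ^ 'n" where "S = (\<lambda>x. (1/2) *\<^sub>R (A *v x + transpose A *v x))"
  define u :: "real ^ 'n \<Rightarrow> real ^ 'n" where "u = (\<lambda>x. (1/2) *\<^sub>R (A *v x - transpose A *v x))"
  have S_linear: "bounded_linear S" and u_linear: "bounded_linear u"
    unfolding S_def u_def
    by (intro bounded_linear_const_scaleR bounded_linear_add bounded_linear_sub
        matrix_vector_mul_bounded_linear)+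
  have gderiv_V: "GDERIV V x :> - S x" for x
    using has_derivative_mult_right[OF gderiv_quadratic_form[of A x, unfolded gderiv_def],
        of "- (1/2)"]
    by (simp add: V_def S_def gderiv_def)
  then have gradient_V: "gradient V x = - S x" for x
    by (rule gradient_eq)
  have V_deriv: "(V has_derivative (\<lambda>h. h \<bullet> - S x)) (at x)" for x
    using gderiv_V by (simp add: gderiv_def)
  have "bounded_linear (\<lambda>x. frechet_derivative V (at x) v)" for v
  proof -
    have "(\<lambda>x. frechet_derivative V (at x) v) = (\<lambda>x. v \<bullet> - S x)"
      by (metis V_deriv frechet_derivative_at)
    then show ?thesis
      using S_linear by (simp only: bounded_linear_inner_right_comp bounded_linear_minus)
  qed
  then have "C_k_on (Suc 2) V UNIV"
    using V_deriv unfolding C_k_on.simps differentiable_def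
    by (blast intro: C_k_on_bounded_linear)
  then have V_C3: "C_k_on 3 V UNIV"
    by (simp only: eval_nat_numeral)
  have u_skew: "u x \<bullet> x = 0" for x
  proof -
    have "(A *v x) \<bullet> x = (transpose A *v x) \<bullet> x"
      by (metis dot_lmul_matrix inner_commute transpose_matrix_vector)
    then show ?thesis
      by (simp add: u_def inner_diff_left)
  qed
  have u_deriv: "(u has_derivative u) (at x)" for x
    using u_linear by (rule bounded_linear_imp_has_derivative)
  \<comment> \<open>Each summand of the trace is a value of the quadratic form that vanishes by skewness.\<close>
  have u_div: "divergence u x = 0" for x
    unfolding divergence_def frechet_derivative_at[OF u_deriv, symmetric] by (simp add: u_skew)
  have split: "F x = - gradient V x + u x" for x
    by (simp add: assms(2) gradient_V S_def u_def scaleR_add_right[symmetric])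
  have "u x \<bullet> gradient V x = 0" for x
  proof -
    have "(A *v x - transpose A *v x) \<bullet> (A *v x + transpose A *v x) = 0"
      using normal_matrix_inner_eq[OF assms(1), of x]
      by (simp add: inner_diff_left inner_add_right
          inner_commute[of "transpose A *v x" "A *v x"] del: transpose_matrix_vector)
    then show ?thesis
      by (simp only: gradient_V S_def u_def inner_scaleR_left inner_scaleR_right inner_minus_right
          mult_zero_right minus_zero)
  qed
  moreover have "Helmholtz_Hodge_decomposition UNIV F V u"
    using V_C3 u_div u_deriv split
    by (auto simp: Helmholtz_Hodge_decomposition_def differentiable_def)
  ultimately show ?thesis
    unfolding strictly_orthogonal_on_def by blast
qed

end
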